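(* Let $f : \mathbb{C}\setminus\{0\} \to \mathbb{C}$ be a continuous function and assume that the limit $\lim_{n\to\infty} f(nz)$ exists in $\mathbb{C}$ for all $z \in \mathbb{C}\setminus\{0\}$. Then the limit $g(\vartheta) = \lim_{t\to\infty} f(te^{i\vartheta})$ (with $t$ real, $t>0$) exists in $\mathbb{C}$ for all $\vartheta \in [0,2\pi]$, and there is a dense $G_\delta$ subset of $[0,2\pi]$ at every point of which the function $g:[0,2\pi]\to\mathbb{C}$ is continuous.
   Context: Here $n$ ranges over $\mathbb{N}=\{1,2,\ldots\}$. A $G_\delta$ subset is a countable intersection of (relatively) open sets. *)

theory Defs
  imports "HOL-Analysis.Analysis"
begin

end

theory Submission
  imports Defs
begin

text \<open>
  Everything rests on one consequence of Baire's category theorem. If continuous functions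
  \<open>u n\<close> converge pointwise to \<open>L\<close> on a complete space, then for every \<open>e > 0\<close> each nonempty open
  set contains a nonempty open subset on which the convergence is uniform up to \<open>e\<close> and \<open>L\<close> oscillates
  by at most \<open>e\<close> (\<open>pointwise_limit_locally_uniform\<close>). It is used twice.

  On a ray, put \<open>h t = f (t * exp (\<i> * \<theta>))\<close> and \<open>L t = lim (h (n * t))\<close>. Passing to subsequences
  gives \<open>L (k * t) = L t\<close> for every integer \<open>k > 0\<close>, so \<open>L\<close> is invariant under multiplication
  by positive rationals, and an interval of small oscillation therefore carries, up to that
  oscillation, all the values of \<open>L\<close>. Hence \<open>L\<close> is a constant \<open>c\<close>. On an interval \<open>{a<..<b}\<close>
  on which \<open>h (n * t)\<close> is \<open>e\<close>-close to \<open>c\<close> for all \<open>n \<ge> N\<close>, the dilates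
  \<open>{n * a<..<n * b}\<close> overlap for large \<open>n\<close> and cover a neighbourhood of infinity, so
  \<open>h\<close> tends to \<open>c\<close> (\<open>tendsto_at_top_if_dilates_converge\<close>).

  Consequently \<open>g \<theta>\<close> is the pointwise limit of the continuous functions
  \<open>\<theta> \<mapsto> f (n * exp (\<i> * \<theta>))\<close>, and such a limit is continuous at the points of a dense
  \<open>G\<^sub>\<delta>\<close> set: the sets where the oscillation of the limit is locally small are open by
  construction and dense by the first lemma (\<open>pointwise_limit_continuous_on_dense_gdelta\<close>).
\<close>

section \<open>Pointwise limits of continuous functions\<close>

text \<open>
  The closed sets on which the tail of the sequence from \<open>N\<close> on varies by at most \<open>e / 4\<close> cover
  \<open>S\<close>. Their frontiers are nowhere dense, so by Baire's theorem some point of \<open>V\<close> lies in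
  none of them, hence in the interior of one of the sets. Continuity of the single function \<open>u N\<close>
  then controls the oscillation of \<open>L\<close> near that point.
\<close>

lemma pointwise_limit_locally_uniform:
  fixes u :: "nat \<Rightarrow> 'a::complete_space \<Rightarrow> 'b::metric_space"
  assumes S: "closed S"
    and cont: "\<And>n. continuous_on S (u n)"
    and lim: "\<And>x. x \<in> S \<Longrightarrow> (\<lambda>n. u n x) \<longlonglongrightarrow> L x"
    and V: "openin (top_of_set S) V" "V \<noteq> {}"
    and e: "e > 0"
  obtains W N where "openin (top_of_set S) W" "W \<noteq> {}" "W \<subseteq> V"
    "\<And>n x. n \<ge> N \<Longrightarrow> x \<in> W \<Longrightarrow> dist (u n x) (L x) \<le> e"
    "\<And>x y. x \<in> W \<Longrightarrow> y \<in> W \<Longrightarrow> dist (L x) (L y) \<le> e"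
proof -
  let ?X = "top_of_set S"
  define A where "A N = {x\<in>S. \<forall>m\<ge>N. \<forall>n\<ge>N. dist (u m x) (u n x) \<le> e / 4}" for N
  have "closed (A N)" for N
  proof -
    have "A N = S \<inter> (\<Inter>m\<in>{N..}. \<Inter>n\<in>{N..}. {x\<in>S. dist (u m x) (u n x) \<le> e / 4})"
      by (auto simp: A_def)
    moreover have "closed {x\<in>S. dist (u m x) (u n x) \<le> e / 4}" for m n
      by (intro continuous_on_closed_Collect_le continuous_intros cont S)
    ultimately show ?thesis
      using S by (auto intro!: closed_Int closed_INT)
  qed
  then have A: "closedin ?X (A N)" for N
    by (intro closed_subset) (auto simp: A_def)
  define F where "F N = A N - ?X interior_of A N" for N
  have "?X interior_of \<Union>(range F) = {}"
  proof (rule Baire_category_alt)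
    show "completely_metrizable_space ?X \<or> locally_compact_space ?X \<and> regular_space ?X"
      using S completely_metrizable_space_closedin completely_metrizable_space_euclidean
      by (metis closed_closedin)
    fix T assume "T \<in> range F"
    then obtain N where T: "T = F N"
      by auto
    have "?X interior_of F N \<subseteq> ?X interior_of A N"
      by (intro interior_of_mono) (auto simp: F_def)
    moreover have "?X interior_of F N \<subseteq> F N"
      by (rule interior_of_subset)
    ultimately have "?X interior_of F N = {}"
      by (auto simp: F_def)
    moreover have "closedin ?X (F N)"
      unfolding F_def by (intro closedin_diff A openin_interior_of)
    ultimately show "closedin ?X T \<and> ?X interior_of T = {}"
      by (simp add: T)
  qed auto
  then have "\<not> V \<subseteq> \<Union>(range F)"
    using V interior_of_maximal by fastforce
  then obtain p where p: "p \<in> V" "\<And>N. p \<notin> F N"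
    by auto
  have pS: "p \<in> S"
    using p V openin_imp_subset by blast
  have "Cauchy (\<lambda>n. u n p)"
    using lim[OF pS] by (rule LIMSEQ_imp_Cauchy)
  then obtain N where "\<And>m n. m \<ge> N \<Longrightarrow> n \<ge> N \<Longrightarrow> dist (u m p) (u n p) < e / 4"
    using e by (metis Cauchy_def zero_less_divide_iff zero_less_numeral)
  then have "p \<in> A N"
    using pS by (auto simp: A_def less_imp_le)
  then have pint: "p \<in> ?X interior_of A N"
    using p(2)[of N] by (auto simp: F_def)
  define W where "W = V \<inter> ?X interior_of A N \<inter> (S \<inter> u N -` ball (u N p) (e / 8))"
  have W_A: "W \<subseteq> A N"
    using interior_of_subset[of ?X "A N"] by (auto simp: W_def)
  have near: "dist (u n x) (L x) \<le> e / 4" if "n \<ge> N" "x \<in> W" for n x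
  proof (rule Lim_dist_ubound[OF trivial_limit_sequentially])
    show "(\<lambda>m. u m x) \<longlonglongrightarrow> L x"
      using lim that W_A by (auto simp: A_def)
    show "\<forall>\<^sub>F m in sequentially. dist (u n x) (u m x) \<le> e / 4"
      using that W_A by (auto simp: A_def eventually_at_top_linorder)
  qed
  show ?thesis
  proof
    show "openin ?X W"
      unfolding W_def
      by (intro openin_Int V openin_interior_of continuous_openin_preimage_gen cont open_ball)
    have "p \<in> W"
      using p pint pS e by (auto simp: W_def)
    then show "W \<noteq> {}"
      by blast
    show "W \<subseteq> V"
      by (auto simp: W_def)
    show "dist (u n x) (L x) \<le> e" if "n \<ge> N" "x \<in> W" for n x
      using near[OF that] e by linarith
    show "dist (L x) (L y) \<le> e" if "x \<in> W" "y \<in> W" for x y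
    proof -
      have "dist (u N p) (u N x) < e / 8" "dist (u N p) (u N y) < e / 8"
        using that by (auto simp: W_def)
      then have "dist (u N x) (u N y) \<le> e / 4"
        using dist_triangle3[of "u N x" "u N y" "u N p"] by linarith
      then show ?thesis
        using near[OF order_refl that(1)] near[OF order_refl that(2)] e
          dist_triangle[of "L x" "L y" "u N x"] dist_triangle[of "u N x" "L y" "u N y"]
          dist_commute[of "L x" "u N x"]
        by linarith
    qed
  qed
qed

text \<open>
  The points having a neighbourhood on which \<open>L\<close> oscillates by at most \<open>1 / Suc k\<close> form an open
  set, which is dense by the preceding lemma. Baire's theorem makes the intersection over \<open>k\<close>
  dense, and \<open>L\<close> is continuous at a point whose oscillation vanishes.
\<close>

lemma pointwise_limit_continuous_on_dense_gdelta:
  fixes u :: "nat \<Rightarrow> 'a::complete_space \<Rightarrow> 'b::metric_space"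
  assumes S: "closed S"
    and cont: "\<And>n. continuous_on S (u n)"
    and lim: "\<And>x. x \<in> S \<Longrightarrow> (\<lambda>n. u n x) \<longlonglongrightarrow> L x"
  obtains D where "gdelta_in (top_of_set S) D" "top_of_set S closure_of D = S"
    "\<And>x. x \<in> D \<Longrightarrow> continuous (at x within S) L"
proof -
  let ?X = "top_of_set S"
  define U where "U k = \<Union>{W. openin ?X W \<and>
      (\<forall>x\<in>W. \<forall>y\<in>W. dist (L x) (L y) \<le> 1 / real (Suc k))}" for k
  have U_open: "openin ?X (U k)" for k
    unfolding U_def by (rule openin_Union) auto
  have U_dense: "?X closure_of (U k) = topspace ?X" for k
  proof -
    have "U k \<inter> V \<noteq> {}" if V: "openin ?X V" "V \<noteq> {}" for V
    proof -
      have "1 / real (Suc k) > 0"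
        by simp
      from pointwise_limit_locally_uniform[OF S cont lim V this]
      obtain W where W: "openin ?X W" "W \<noteq> {}" "W \<subseteq> V"
        "\<And>x y. x \<in> W \<Longrightarrow> y \<in> W \<Longrightarrow> dist (L x) (L y) \<le> 1 / real (Suc k)"
        by metis
      then have "W \<subseteq> U k"
        unfolding U_def by blast
      with W show ?thesis
        by blast
    qed
    then show ?thesis
      unfolding dense_intersects_open by blast
  qed
  show ?thesis
  proof
    show "gdelta_in ?X (\<Inter>(range U))"
      by (intro gdelta_in_Inter) (auto intro: open_imp_gdelta_in U_open)
    have "?X closure_of \<Inter>(range U) = topspace ?X"
    proof (rule Baire_category)
      show "completely_metrizable_space ?X \<or> locally_compact_space ?X \<and> regular_space ?X"
        using S completely_metrizable_space_closedin completely_metrizable_space_euclidean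
        by (metis closed_closedin)
    qed (use U_open U_dense in auto)
    then show "?X closure_of \<Inter>(range U) = S"
      by simp
    fix x assume x: "x \<in> \<Inter>(range U)"
    show "continuous (at x within S) L"
      unfolding continuous_within_eps_delta
    proof (intro allI impI)
      fix e :: real assume "e > 0"
      then obtain k where k: "1 / real (Suc k) < e"
        using nat_approx_posE by blast
      obtain W where W: "openin ?X W" "x \<in> W"
        "\<forall>y\<in>W. \<forall>z\<in>W. dist (L y) (L z) \<le> 1 / real (Suc k)"
      proof -
        have "x \<in> U k"
          using x by simp
        then show ?thesis
          using that unfolding U_def by (elim UnionE CollectE conjE)
      qed
      then obtain d where "d > 0" "ball x d \<inter> S \<subseteq> W"
        unfolding openin_contains_ball by blast
      then have "dist (L y) (L x) < e" if "y \<in> S" "dist y x < d" for y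
      proof -
        have "y \<in> W"
          using that \<open>ball x d \<inter> S \<subseteq> W\<close> by (auto simp: dist_commute)
        then have "dist (L y) (L x) \<le> 1 / real (Suc k)"
          using W(2,3) by blast
        then show ?thesis
          using k by linarith
      qed
      then show "\<exists>d>0. \<forall>y\<in>S. dist y x < d \<longrightarrow> dist (L y) (L x) < e"
        using \<open>d > 0\<close> by blast
    qed
  qed
qed

section \<open>Limits at infinity along dilates\<close>

text \<open>
  For a limit known in advance to be \<open>0\<close> this is Croft's lemma; here the
  independence of the limit from \<open>t\<close> is part of the conclusion.
\<close>

lemma tendsto_at_top_if_dilates_converge:
  fixes h :: "real \<Rightarrow> 'a::metric_space"
  assumes cont: "continuous_on {0<..} h"
    and conv: "\<And>t. t > 0 \<Longrightarrow> \<exists>l. (\<lambda>n. h (real n * t)) \<longlonglongrightarrow> l"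
  shows "\<exists>l. (h \<longlongrightarrow> l) at_top"
proof -
  obtain L where L: "(\<lambda>n. h (real n * t)) \<longlonglongrightarrow> L t" if "t > 0" for t
    using conv by metis
  have L_mult: "L (real k * t) = L t" if "t > 0" "k > 0" for k :: nat and t
  proof (rule LIMSEQ_unique)
    show "(\<lambda>n. h (real n * (real k * t))) \<longlonglongrightarrow> L (real k * t)"
      using L[of "real k * t"] that by simp
    have "strict_mono (\<lambda>n. n * k)"
      using that by (simp add: strict_mono_def)
    from LIMSEQ_subseq_LIMSEQ[OF L[OF that(1)] this]
    show "(\<lambda>n. h (real n * (real k * t))) \<longlonglongrightarrow> L t"
      by (simp add: o_def mult.assoc)
  qed
  have L_into: "\<exists>s. a < s \<and> s < b \<and> L s = L t" if "t > 0" "0 < a" "a < b" for a b t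
  proof -
    obtain r where r: "r \<in> \<rat>" "a / t < r" "r < b / t"
      using Rats_dense_in_real[of "a / t" "b / t"] \<open>t > 0\<close> \<open>a < b\<close> by (auto simp: divide_strict_right_mono)
    have "r > 0"
      using r \<open>t > 0\<close> \<open>0 < a\<close> by (meson divide_pos_pos less_trans)
    then obtain i j :: nat where ij: "j \<noteq> 0" "r = real i / real j"
      using Rats_abs_nat_div_natE[OF r(1)] by (metis abs_of_pos)
    then have "i > 0"
      using \<open>r > 0\<close> by (cases i) auto
    have "L (real j * (r * t)) = L (r * t)"
      using ij(1) \<open>r > 0\<close> \<open>t > 0\<close> by (intro L_mult) auto
    moreover have "real j * (r * t) = real i * t"
      using ij by simp
    ultimately have "L (r * t) = L t"
      using L_mult[OF \<open>t > 0\<close> \<open>i > 0\<close>] by simp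
    moreover have "a < r * t" "r * t < b"
      using r \<open>t > 0\<close> by (simp_all add: field_simps)
    ultimately show ?thesis
      by blast
  qed
  have window: "\<exists>a b N. 0 < a \<and> a < b \<and>
      (\<forall>n\<ge>N. \<forall>t\<in>{a<..<b}. dist (h (real n * t)) (L t) \<le> e) \<and>
      (\<forall>s\<in>{a<..<b}. \<forall>t\<in>{a<..<b}. dist (L s) (L t) \<le> e)" if "e > 0" for e
  proof -
    \<comment> \<open>The shift by one keeps the arguments of \<open>h\<close> away from \<open>0\<close> at index \<open>0\<close>.\<close>
    have c: "continuous_on {1..2} (\<lambda>t. h (real (Suc n) * t))" for n
      by (rule continuous_on_compose2[OF cont]) (auto intro!: continuous_intros simp del: of_nat_Suc)
    have l: "(\<lambda>n. h (real (Suc n) * t)) \<longlonglongrightarrow> L t" if "t \<in> {1..2}" for t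
      using LIMSEQ_Suc[OF L[of t]] that by simp
    have V: "openin (top_of_set {1..2}) {1<..<2::real}" "{1<..<2::real} \<noteq> {}"
      by (auto intro: open_subset)
    obtain W N where W: "openin (top_of_set {1..2}) W" "W \<noteq> {}" "W \<subseteq> {1<..<2}"
      "\<And>n t. n \<ge> N \<Longrightarrow> t \<in> W \<Longrightarrow> dist (h (real (Suc n) * t)) (L t) \<le> e"
      "\<And>s t. s \<in> W \<Longrightarrow> t \<in> W \<Longrightarrow> dist (L s) (L t) \<le> e"
      using pointwise_limit_locally_uniform[OF closed_atLeastAtMost c l V \<open>e > 0\<close>] by metis
    then have "openin (top_of_set {1<..<2}) W"
      by (auto intro: openin_subset_trans)
    then have "open W"
      by (simp add: openin_open_eq)
    then obtain p d where p: "p \<in> W" "d > 0" "ball p d \<subseteq> W"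
      using W(2) open_contains_ball by blast
    then have sub: "{p<..<p + d} \<subseteq> W"
      by (auto simp: ball_eq_greaterThanLessThan)
    have "dist (h (real n * t)) (L t) \<le> e" if "n \<ge> Suc N" "t \<in> {p<..<p + d}" for n t
      using W(4)[of "n - 1" t] that sub by (cases n) auto
    moreover have "dist (L s) (L t) \<le> e" if "s \<in> {p<..<p + d}" "t \<in> {p<..<p + d}" for s t
      using W(5) sub that by blast
    moreover have "0 < p"
      using p W(3) by force
    ultimately show ?thesis
      using p(2)
      by - (rule exI[of _ p], rule exI[of _ "p + d"], rule exI[of _ "Suc N"], auto)
  qed
  have L_const: "L t = L 1" if "t > 0" for t
  proof -
    have "dist (L t) (L 1) \<le> e" if "e > 0" for e
    proof -
      obtain a b N where ab: "0 < a" "a < b" "\<forall>s\<in>{a<..<b}. \<forall>t\<in>{a<..<b}. dist (L s) (L t) \<le> e"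
        using window[OF \<open>e > 0\<close>] by metis
      obtain s where "a < s" "s < b" "L s = L t"
        using L_into[OF \<open>t > 0\<close> ab(1,2)] by blast
      moreover obtain s' where "a < s'" "s' < b" "L s' = L 1"
        using L_into[OF zero_less_one ab(1,2)] by blast
      ultimately show ?thesis
        using ab(3) by (metis greaterThanLessThan_iff)
    qed
    then show ?thesis
      using zero_less_dist_iff[of "L t" "L 1"] by (metis dense not_le)
  qed
  have "(h \<longlongrightarrow> L 1) at_top"
  proof (rule tendstoI)
    fix e :: real assume "e > 0"
    then have "e / 2 > 0"
      by simp
    from window[OF this] obtain a b N where ab: "0 < a" "a < b"
      and N: "\<forall>n\<ge>N. \<forall>t\<in>{a<..<b}. dist (h (real n * t)) (L t) \<le> e / 2"
      by metis
    have gap: "1 / a - 1 / b > 0"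
      using ab by (simp add: frac_less2)
    \<comment> \<open>Beyond the two bounds the interval from \<open>x / b\<close> to \<open>x / a\<close> has length above \<open>1\<close> and
      starts above \<open>N\<close>, so it contains an admissible integer \<open>n\<close>.\<close>
    have "dist (h x) (L 1) < e" if x: "x > b * real N" "x > 1 / (1 / a - 1 / b)" for x
    proof -
      have "x > 0"
        using x(1) ab by (smt (verit) mult_nonneg_nonneg of_nat_0_le_iff)
      define n where "n = Suc (nat \<lfloor>x / b\<rfloor>)"
      have n: "x / b < real n" "real n \<le> x / b + 1"
        unfolding n_def using \<open>x > 0\<close> ab by (simp_all, linarith)
      have "x / b + 1 < x / a"
        using x(2) gap by (simp add: pos_divide_less_eq algebra_simps)
      with n have "real n < x / a"
        by linarith
      moreover have "real n > 0"
        by (simp add: n_def)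
      ultimately have "x / real n \<in> {a<..<b}"
        using n ab by (auto simp: field_simps)
      moreover have "real N < x / b"
        using x(1) ab by (simp add: pos_less_divide_eq mult.commute)
      then have "n \<ge> N"
        using n by linarith
      ultimately have "dist (h (real n * (x / real n))) (L (x / real n)) \<le> e / 2"
        using N by blast
      moreover have "L (x / real n) = L 1"
        using \<open>x > 0\<close> \<open>real n > 0\<close> by (intro L_const) simp
      ultimately show ?thesis
        using \<open>real n > 0\<close> \<open>e > 0\<close> by simp
    qed
    then show "\<forall>\<^sub>F x in at_top. dist (h x) (L 1) < e"
      using eventually_conj[OF eventually_gt_at_top[of "b * real N"]
          eventually_gt_at_top[of "1 / (1 / a - 1 / b)"]]
      by (auto elim: eventually_mono)
  qed
  then show ?thesis
    by blast
qed

section \<open>Radial limits in the punctured plane\<close>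

theorem mainTheorem6:
  fixes f :: "complex \<Rightarrow> complex"
  assumes "continuous_on (UNIV - {0}) f"
    and "\<And>z. z \<noteq> 0 \<Longrightarrow> \<exists>l. (\<lambda>n::nat. f (of_nat n * z)) \<longlonglongrightarrow> l"
  shows "\<exists>g :: real \<Rightarrow> complex.
    (\<forall>\<theta>\<in>{0..2 * pi}. ((\<lambda>t::real. f (of_real t * exp (\<i> * of_real \<theta>))) \<longlongrightarrow> g \<theta>) at_top) \<and>
    (\<exists>D. gdelta_in (top_of_set {0..2 * pi}) D \<and>
         top_of_set {0..2 * pi} closure_of D = {0..2 * pi} \<and>
         (\<forall>\<theta>\<in>D. continuous (at \<theta> within {0..2 * pi}) g))"
proof -
  have "\<exists>l. ((\<lambda>t::real. f (of_real t * exp (\<i> * of_real \<theta>))) \<longlongrightarrow> l) at_top" for \<theta> :: real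
  proof (rule tendsto_at_top_if_dilates_converge)
    show "continuous_on {0<..} (\<lambda>t::real. f (of_real t * exp (\<i> * of_real \<theta>)))"
      by (rule continuous_on_compose2[OF assms(1)]) (auto intro!: continuous_intros)
    fix t :: real assume "t > 0"
    then show "\<exists>l. (\<lambda>n. f (of_real (real n * t) * exp (\<i> * of_real \<theta>))) \<longlonglongrightarrow> l"
      using assms(2)[of "of_real t * exp (\<i> * of_real \<theta>)"] by (simp add: mult.assoc)
  qed
  then obtain g where
    g: "((\<lambda>t::real. f (of_real t * exp (\<i> * of_real \<theta>))) \<longlongrightarrow> g \<theta>) at_top" for \<theta> :: real
    by metis
  let ?u = "\<lambda>n (\<theta>::real). f (of_real (real (Suc n)) * exp (\<i> * of_real \<theta>))"
  have cont: "continuous_on {0..2 * pi} (?u n)" for n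
    by (rule continuous_on_compose2[OF assms(1)])
      (auto intro!: continuous_intros simp del: of_nat_Suc)
  have lim: "(\<lambda>n. ?u n \<theta>) \<longlonglongrightarrow> g \<theta>" for \<theta>
    by (rule filterlim_compose[OF g filterlim_compose[OF filterlim_real_sequentially filterlim_Suc]])
  obtain D where "gdelta_in (top_of_set {0..2 * pi}) D"
    "top_of_set {0..2 * pi} closure_of D = {0..2 * pi}"
    "\<And>\<theta>. \<theta> \<in> D \<Longrightarrow> continuous (at \<theta> within {0..2 * pi}) g"
    using pointwise_limit_continuous_on_dense_gdelta[OF closed_atLeastAtMost cont lim] by blast
  with g show ?thesis
    by blast
qed

end
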